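(* For all integers $n\geq 0$ and $k>0$, $$(-1)^{k} \left( b_6(n) - \sum_{j=-(k-1)}^{k} (-1)^j\, p\big(n-3j(3j-1)\big) \right)\geq 0,$$ with strict inequality if $n\geq 3k(3k+1)$.
   Context: $p(n)$ denotes the number of partitions of $n$, with $p(0)=1$ and $p(n)=0$ for $n<0$. A partition is called $6$-regular if none of its parts is divisible by $6$; $b_6(n)$ denotes the number of $6$-regular partitions of $n$ (with $b_6(0)=1$). *)

theory Defs
  imports "HOL-Library.Multiset"
begin

definition int_partitions :: "nat \<Rightarrow> nat multiset set" where
  "int_partitions n = {M. (\<forall>x\<in>#M. x > 0) \<and> sum_mset M = n}"

(* Guarantees that the cardinalities below are genuine counts (card is 0 on infinite sets). *)
lemma finite_int_partitions: "finite (int_partitions n)"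
proof (rule finite_subset)
  show "int_partitions n \<subseteq> mset ` {xs. set xs \<subseteq> {..n} \<and> length xs \<le> n}"
  proof
    fix M assume "M \<in> int_partitions n"
    then have pos: "\<forall>x\<in>#M. x > 0" and s: "sum_mset M = n"
      by (auto simp: int_partitions_def)
    obtain xs where M: "M = mset xs" by (metis ex_mset)
    have sl: "sum_list xs = n" using s M by (simp add: sum_mset_sum_list)
    have "set xs \<subseteq> {..n}" using member_le_sum_list[of _ xs] sl by auto
    moreover have "length xs \<le> n"
    proof -
      have "(\<forall>x\<in>set ys. x > 0) \<Longrightarrow> length ys \<le> sum_list ys" for ys :: "nat list"
        by (induction ys) fastforce+
      from this[of xs] show ?thesis using pos M sl by simp
    qed
    ultimately show "M \<in> mset ` {xs. set xs \<subseteq> {..n} \<and> length xs \<le> n}"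
      using M by blast
  qed
  show "finite (mset ` {xs. set xs \<subseteq> {..n} \<and> length xs \<le> n})"
    by (intro finite_imageI finite_lists_length_le) simp
qed

definition num_partitions :: "int \<Rightarrow> nat" where
  "num_partitions m = (if m < 0 then 0 else card (int_partitions (nat m)))"

definition num_regular_partitions :: "nat \<Rightarrow> nat \<Rightarrow> nat" where
  "num_regular_partitions l n = card {M \<in> int_partitions n. \<forall>x\<in>#M. \<not> l dvd x}"

lemma int_partitions_0: "int_partitions 0 = {{#}}"
proof -
  have "M = {#}" if "M \<in> int_partitions 0" for M
    using that by (cases M) (simp_all add: int_partitions_def)
  then show ?thesis by (auto simp: int_partitions_def)
qed

lemma num_partitions_0: "num_partitions 0 = 1"
  by (simp add: num_partitions_def int_partitions_0)

lemma num_regular_partitions_0: "num_regular_partitions l 0 = 1"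
proof -
  have "{M \<in> int_partitions 0. \<forall>x\<in>#M. \<not> l dvd x} = {{#}}"
    by (auto simp: int_partitions_0)
  then show ?thesis by (simp add: num_regular_partitions_def)
qed

(* The sign (-1)^j for an integer exponent j of either sign; the ring int has no inverses,
   and (-1)^j = (-1)^(-j). *)
abbreviation int_sign :: "int \<Rightarrow> int" where
  "int_sign j \<equiv> (-1) ^ nat \<bar>j\<bar>"

end

theory Submission
  imports Defs "HOL-Computational_Algebra.Formal_Power_Series"
begin

text \<open>Let \<open>q = X ^ 6\<close>. The \<open>6\<close>-regular partitions have the generating function \<open>B = P (q; q)\<^sub>\<infinity>\<close>, where \<open>P\<close>
  is that of all partitions. Andrews and Merca's truncation of Euler's pentagonal number theorem,
  \<open>T\<^sub>k / (q; q)\<^sub>\<infinity> = 1 + (-1) ^ (k - 1) F\<^sub>k\<close> with \<open>T\<^sub>k\<close> the partial sum over \<open>- (k - 1) \<le> j \<le> k\<close>, then turns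
  the signed difference into a coefficient of \<open>F\<^sub>k B\<close>. Both factors have nonnegative coefficients,
  the one of \<open>F\<^sub>k\<close> at \<open>X ^ (3 k (3 k + 1))\<close> is positive, and so are all coefficients of \<open>B\<close>.
  The identity follows by induction on \<open>k\<close>: when \<open>F\<^sub>k + F\<^sub>k\<^sub>+\<^sub>1\<close> is combined termwise, the factor
  \<open>1 - q ^ n\<close> cancels and two instances of Euler's series
  \<open>\<Sum>m. z ^ m / (q)\<^sub>m = 1 / (z; q)\<^sub>\<infinity>\<close> remain.\<close>

unbundle fps_syntax

section \<open>Generating functions of partitions with restricted parts\<close>

text \<open>If \<open>0 \<in> A\<close>, each of these sets is empty or infinite, so
  \<open>card\<close> gives 0; hence the hypothesis \<open>0 \<notin> A\<close> in lemmas
  below.\<close>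

definition partitions_into :: "nat set \<Rightarrow> nat \<Rightarrow> nat multiset set" where
  "partitions_into A n = {M. set_mset M \<subseteq> A \<and> sum_mset M = n}"

definition gf_parts :: "nat set \<Rightarrow> int fps" where
  "gf_parts A = Abs_fps (\<lambda>n. int (card (partitions_into A n)))"

lemma gf_parts_nth [simp]: "gf_parts A $ n = int (card (partitions_into A n))"
  by (simp add: gf_parts_def)

lemma finite_partitions_into:
  assumes "0 \<notin> A"
  shows "finite (partitions_into A n)"
proof (rule finite_subset[OF _ finite_int_partitions])
  show "partitions_into A n \<subseteq> int_partitions n"
    using assms by (fastforce simp: partitions_into_def int_partitions_def intro: gr0I)
qed

lemma partitions_into_0:
  assumes "0 \<notin> A"
  shows "partitions_into A 0 = {{#}}"
proof -
  have "M = {#}" if "set_mset M \<subseteq> A" "sum_mset M = 0" for M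
    using that assms by (cases M) auto
  then show ?thesis by (auto simp: partitions_into_def)
qed

lemma partitions_into_eq_empty:
  assumes "\<And>x. x \<in> A \<Longrightarrow> x > n" "n > 0"
  shows "partitions_into A n = {}"
proof -
  have False if M: "set_mset M \<subseteq> A" "sum_mset M = n" for M
  proof (cases M)
    case empty
    then show ?thesis using M assms by simp
  next
    case (add x N)
    then have "x \<in> A" "x \<le> n" using M by auto
    then show ?thesis using assms(1)[of x] by simp
  qed
  then show ?thesis by (auto simp: partitions_into_def)
qed

lemma gf_parts_nth_0: "0 \<notin> A \<Longrightarrow> gf_parts A $ 0 = 1"
  by (simp add: partitions_into_0)

lemma gf_parts_empty: "gf_parts {} = 1"
  proof (rule fps_ext)
  fix n
  show "gf_parts {} $ n = 1 $ n"
    using partitions_into_eq_empty[of "{}" n] by (cases "n = 0") (simp_all add: partitions_into_0)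
qed

text \<open>A partition into parts from \<open>A \<union> B\<close> splits uniquely by membership in
  \<open>A\<close>; the sum of the portion in \<open>A\<close> is the index of the Cauchy
  product.\<close>

lemma gf_parts_Un:
  assumes disj: "A \<inter> B = {}" and "0 \<notin> A" "0 \<notin> B"
  shows "gf_parts (A \<union> B) = gf_parts A * gf_parts B"
proof (rule fps_ext)
  fix n
  let ?S = "SIGMA i:{0..n}. partitions_into A i \<times> partitions_into B (n - i)"
  have "bij_betw (\<lambda>(i, M, N). M + N) ?S (partitions_into (A \<union> B) n)"
  proof (rule bij_betw_byWitness[where f' =
        "\<lambda>M. (sum_mset {#x\<in>#M. x \<in> A#}, {#x\<in>#M. x \<in> A#}, {#x\<in>#M. x \<notin> A#})"])
    have "{#x \<in># M + N. x \<in> A#} = M \<and> {#x \<in># M + N. x \<notin> A#} = N"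
      if "set_mset M \<subseteq> A" "set_mset N \<subseteq> B" for M N
    proof -
      have "{#x \<in># M. x \<in> A#} = M" "{#x \<in># M. x \<notin> A#} = {#}"
        "{#x \<in># N. x \<in> A#} = {#}" "{#x \<in># N. x \<notin> A#} = N"
        using that disj by (auto simp: filter_mset_eq_conv)
      then show ?thesis by simp
    qed
    then show "\<forall>a\<in>?S. (\<lambda>M. (sum_mset {#x\<in>#M. x \<in> A#}, {#x\<in>#M. x \<in> A#}, {#x\<in>#M. x \<notin> A#}))
        ((\<lambda>(i, M, N). M + N) a) = a"
      by (auto simp: partitions_into_def)
    show "\<forall>M\<in>partitions_into (A \<union> B) n. (\<lambda>(i, M, N). M + N)
        (sum_mset {#x\<in>#M. x \<in> A#}, {#x\<in>#M. x \<in> A#}, {#x\<in>#M. x \<notin> A#}) = M"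
      by (simp add: multiset_partition[symmetric])
    show "(\<lambda>(i, M, N). M + N) ` ?S \<subseteq> partitions_into (A \<union> B) n"
      by (auto simp: partitions_into_def)
    have "sum_mset M = sum_mset {#x\<in>#M. x \<in> A#} + sum_mset {#x\<in>#M. x \<notin> A#}" for M
      by (metis multiset_partition sum_mset.union)
    then have "sum_mset {#x\<in>#M. x \<in> A#} \<le> sum_mset M"
      "sum_mset {#x\<in>#M. x \<notin> A#} = sum_mset M - sum_mset {#x\<in>#M. x \<in> A#}" for M
      by (metis le_add1, metis add_diff_cancel_left')
    then show "(\<lambda>M. (sum_mset {#x\<in>#M. x \<in> A#}, {#x\<in>#M. x \<in> A#}, {#x\<in>#M. x \<notin> A#}))
        ` partitions_into (A \<union> B) n \<subseteq> ?S"
      by (fastforce simp: partitions_into_def)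
  qed
  then have "card (partitions_into (A \<union> B) n) = card ?S"
    by (rule bij_betw_same_card[symmetric])
  also have "\<dots> = (\<Sum>i=0..n. card (partitions_into A i) * card (partitions_into B (n - i)))"
    using assms by (simp add: card_SigmaI finite_partitions_into card_cartesian_product)
  finally show "gf_parts (A \<union> B) $ n = (gf_parts A * gf_parts B) $ n"
    by (simp add: fps_mult_nth)
qed

lemma partitions_into_singleton:
  assumes "a > 0"
  shows "partitions_into {a} n = (if a dvd n then {replicate_mset (n div a) a} else {})"
proof -
  have "M = replicate_mset (n div a) a \<and> a dvd n" if "set_mset M \<subseteq> {a}" "sum_mset M = n" for M
  proof -
    have "M = replicate_mset (size M) a"
      using that(1) by (simp add: set_mset_subset_singletonD)
    moreover from this have "n = size M * a"
      using that(2) by (metis sum_mset_replicate_mset of_nat_id)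
    ultimately show ?thesis using assms by simp
  qed
  then show ?thesis
    by (auto simp: partitions_into_def split: if_splits)
qed

lemma gf_parts_singleton:
  assumes "a > 0"
  shows "(1 - fps_X ^ a) * gf_parts {a} = 1"
proof (rule fps_ext)
  fix n
  have "(gf_parts {a} - fps_X ^ a * gf_parts {a}) $ n = (1 :: int fps) $ n"
  proof (cases "n < a")
    case True
    then show ?thesis using assms
      by (auto simp: fps_X_power_mult_nth partitions_into_singleton dest: dvd_imp_le)
  next
    case False
    then show ?thesis using assms
      by (auto simp: fps_X_power_mult_nth partitions_into_singleton dvd_diff_nat
          dest: dvd_diffD)
  qed
  then show "((1 - fps_X ^ a) * gf_parts {a}) $ n = (1 :: int fps) $ n"
    by (simp add: algebra_simps)
qed

lemma gf_parts_insert: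
  assumes "a > 0" "a \<notin> A" "0 \<notin> A"
  shows "gf_parts (insert a A) = gf_parts {a} * gf_parts A"
  using gf_parts_Un[of "{a}" A] assms by simp

section \<open>Coefficientwise sums\<close>

text \<open>The sum of the series \<open>f n\<close> in the \<open>X\<close>-adic topology, provided that \<open>X ^ n\<close> divides \<open>f n\<close>;
  otherwise it drops terms.\<close>

definition fps_total :: "(nat \<Rightarrow> int fps) \<Rightarrow> int fps" where
  "fps_total f = Abs_fps (\<lambda>N. \<Sum>n\<le>N. f n $ N)"

lemma fps_total_nth: "fps_total f $ N = (\<Sum>n\<le>N. f n $ N)"
  by (simp add: fps_total_def)

lemma fps_X_power_dvd_nth:
  fixes f :: "int fps"
  assumes "fps_X ^ n dvd f" "i < n"
  shows "f $ i = 0"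
  using assms by (auto simp: dvd_def fps_X_power_mult_nth)

lemma fps_total_add: "fps_total f + fps_total g = fps_total (\<lambda>n. f n + g n)"
  by (rule fps_ext) (simp add: fps_total_nth sum.distrib)

lemma fps_total_diff: "fps_total f - fps_total g = fps_total (\<lambda>n. f n - g n)"
  by (rule fps_ext) (simp add: fps_total_nth sum_subtractf)

text \<open>The coefficients of \<open>f n\<close> below degree \<open>n\<close> vanish, so the
  inner sums extend to the common range \<open>n \<le> N\<close> and the summations can be
  exchanged.\<close>

lemma fps_total_mult:
  assumes dvd: "\<And>n. fps_X ^ n dvd f n"
  shows "c * fps_total f = fps_total (\<lambda>n. c * f n)"
proof (rule fps_ext)
  fix N
  have "(c * fps_total f) $ N = (\<Sum>i=0..N. \<Sum>n\<le>N - i. c $ i * f n $ (N - i))"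
    by (simp add: fps_mult_nth fps_total_nth sum_distrib_left)
  also have "\<dots> = (\<Sum>i=0..N. \<Sum>n\<le>N. c $ i * f n $ (N - i))"
    by (intro sum.cong sum.mono_neutral_left ballI)
       (auto intro: fps_X_power_dvd_nth[OF dvd])
  also have "\<dots> = (\<Sum>n\<le>N. \<Sum>i=0..N. c $ i * f n $ (N - i))"
    by (rule sum.swap)
  finally show "(c * fps_total f) $ N = fps_total (\<lambda>n. c * f n) $ N"
    by (simp add: fps_mult_nth fps_total_nth)
qed

lemma fps_total_Suc:
  assumes dvd: "\<And>n. fps_X ^ n dvd f n"
  shows "fps_total f = f 0 + fps_total (\<lambda>n. f (Suc n))"
proof (rule fps_ext)
  fix N
  \<comment> \<open>The added term \<open>n = N + 1\<close> is 0 at degree \<open>N\<close>; it is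
    the last term of the shifted sum.\<close>
  have "fps_total f $ N = (\<Sum>n\<le>Suc N. f n $ N)"
    using fps_X_power_dvd_nth[OF dvd, of N "Suc N"] by (simp add: fps_total_nth)
  also have "\<dots> = f 0 $ N + (\<Sum>n\<le>N. f (Suc n) $ N)"
    by (rule sum.atMost_Suc_shift)
  finally show "fps_total f $ N = (f 0 + fps_total (\<lambda>n. f (Suc n))) $ N"
    by (simp add: fps_total_nth)
qed

text \<open>Stands in for limits of infinite products: tails equal to 1 up to degree
  \<open>n\<close> drop out of the coefficient at \<open>n\<close>.\<close>

lemma fps_mult_nth_eq_left:
  fixes f h :: "int fps"
  assumes "h $ 0 = 1" "\<And>i. 0 < i \<Longrightarrow> i \<le> n \<Longrightarrow> h $ i = 0"
  shows "(f * h) $ n = f $ n"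
proof -
  have "(f * h) $ n = (\<Sum>i=0..n. if i = n then f $ i else 0)"
    unfolding fps_mult_nth by (intro sum.cong) (use assms in auto)
  then show ?thesis by simp
qed

definition fps_nonneg :: "int fps \<Rightarrow> bool" where
  "fps_nonneg f \<longleftrightarrow> (\<forall>n. f $ n \<ge> 0)"

lemma fps_nonneg_gf_parts: "fps_nonneg (gf_parts A)"
  by (simp add: fps_nonneg_def)

lemma fps_nonneg_mult: "fps_nonneg f \<Longrightarrow> fps_nonneg g \<Longrightarrow> fps_nonneg (f * g)"
  by (simp add: fps_nonneg_def fps_mult_nth sum_nonneg)

lemma fps_nonneg_X_power: "fps_nonneg (fps_X ^ n)"
  by (simp add: fps_nonneg_def fps_X_power_nth)

lemma fps_nonneg_total: "(\<And>n. fps_nonneg (f n)) \<Longrightarrow> fps_nonneg (fps_total f)"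
  by (simp add: fps_nonneg_def fps_total_nth sum_nonneg)

section \<open>The truncated pentagonal number theorem\<close>

text \<open>The generalised pentagonal number \<open>k (3 k + 1) / 2\<close>.\<close>

definition pent :: "nat \<Rightarrow> nat" where "pent k = (k choose 2) + k * (k + 1)"

locale dilation =
  fixes d :: nat
  assumes d_pos: "d > 0"
begin

definition q :: "int fps" where "q = fps_X ^ d"

text \<open>With \<open>(q)\<^sub>m = (1 - q) \<dots> (1 - q ^ m)\<close>, the series \<open>R m\<close>, \<open>G n\<close> and \<open>E a\<close> are \<open>1 / (q)\<^sub>m\<close>,
  \<open>1 / (1 - q ^ n)\<close> and \<open>1 / ((1 - q ^ a) (1 - q ^ (a + 1)) \<dots>)\<close>; defining them through partitions
  avoids division in the ring \<open>int fps\<close>. \<open>F k\<close> is the Andrews--Merca series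
  \<open>\<Sum>n\<ge>k. q ^ ((k choose 2) + (k + 1) n) / (q)\<^sub>n * [n - 1, k - 1]\<close> with a Gaussian binomial coefficient,
  re-indexed by \<open>n = m + k\<close>.\<close>

definition R :: "nat \<Rightarrow> int fps" where "R m = gf_parts ((*) d ` {1..m})"

definition G :: "nat \<Rightarrow> int fps" where "G n = gf_parts {d * n}"

definition E :: "nat \<Rightarrow> int fps" where "E a = fps_total (\<lambda>m. q ^ (a * m) * R m)"

definition F :: "nat \<Rightarrow> int fps" where
  "F k = q ^ (k choose 2) * R (k - 1) *
     fps_total (\<lambda>m. q ^ ((k + 1) * (m + k)) * G (m + k) * R m)"

section \<open>Euler's series for infinite products\<close>

lemma q_power: "q ^ n = fps_X ^ (d * n)"
  by (simp add: q_def power_mult)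

lemma X_dvd_q: "m \<le> n \<Longrightarrow> fps_X ^ m dvd q ^ n"
  using d_pos by (auto simp: q_power intro!: le_imp_power_dvd intro: order_trans)

lemma q_G: "n > 0 \<Longrightarrow> (1 - q ^ n) * G n = 1"
  using gf_parts_singleton[of "d * n"] d_pos by (simp add: G_def q_power)

lemma R_0: "R 0 = 1"
  by (simp add: R_def gf_parts_empty)

lemma R_Suc: "R (Suc m) = G (Suc m) * R m"
proof -
  have "(*) d ` {1..Suc m} = insert (d * Suc m) ((*) d ` {1..m})"
    by (simp add: atLeastAtMostSuc_conv)
  then show ?thesis
    unfolding R_def G_def using d_pos
    by (subst gf_parts_insert[symmetric]) (auto simp del: mult_Suc_right)
qed

lemma q_R_Suc: "(1 - q ^ Suc m) * R (Suc m) = R m"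
proof -
  have "(1 - q ^ Suc m) * R (Suc m) = ((1 - q ^ Suc m) * G (Suc m)) * R m"
    by (simp only: R_Suc mult.assoc)
  then show ?thesis by (simp only: q_G zero_less_Suc mult_1)
qed

text \<open>The terms of \<open>E a - E (Suc a)\<close> carry a factor \<open>1 - q ^ m\<close>,
  which is 0 at \<open>m = 0\<close> and otherwise turns \<open>R m\<close> into
  \<open>R (m - 1)\<close>; an index shift then gives \<open>q ^ a * E a\<close>.\<close>

lemma E_Suc:
  assumes "a > 0"
  shows "E (Suc a) = (1 - q ^ a) * E a"
proof -
  have dvd: "fps_X ^ m dvd q ^ (a * m) * R m" for m
    using assms by (intro dvd_mult2 X_dvd_q) simp
  have dvd': "fps_X ^ m dvd q ^ (a * m) * R m - q ^ (Suc a * m) * R m" for m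
    using assms by (intro dvd_diff dvd_mult2 X_dvd_q) simp_all
  have "E a - E (Suc a) = fps_total (\<lambda>m. q ^ (a * m) * R m - q ^ (Suc a * m) * R m)"
    by (simp add: E_def fps_total_diff)
  also have "\<dots> = fps_total (\<lambda>m. q ^ (a * Suc m) * R (Suc m) - q ^ (Suc a * Suc m) * R (Suc m))"
    by (subst fps_total_Suc[OF dvd']) simp
  also have "(\<lambda>m. q ^ (a * Suc m) * R (Suc m) - q ^ (Suc a * Suc m) * R (Suc m))
      = (\<lambda>m. q ^ a * (q ^ (a * m) * R m))"
  proof
    fix m
    have "q ^ (a * Suc m) * R (Suc m) - q ^ (Suc a * Suc m) * R (Suc m)
        = q ^ (a * Suc m) * ((1 - q ^ Suc m) * R (Suc m))"
      by (simp add: algebra_simps power_add)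
    then show "q ^ (a * Suc m) * R (Suc m) - q ^ (Suc a * Suc m) * R (Suc m)
        = q ^ a * (q ^ (a * m) * R m)"
      by (simp only: q_R_Suc) (simp add: power_add mult.assoc)
  qed
  also have "fps_total \<dots> = q ^ a * E a"
    by (simp add: E_def fps_total_mult[OF dvd])
  finally show ?thesis by (simp add: algebra_simps)
qed

lemma E_1: "E 1 = R k * E (k + 1)"
proof (induction k)
  case (Suc k)
  have "R (Suc k) * E (Suc k + 1) = ((1 - q ^ Suc k) * R (Suc k)) * E (k + 1)"
    by (simp add: E_Suc mult_ac)
  then show ?case by (simp only: q_R_Suc Suc.IH)
qed (simp add: R_0)

text \<open>At degree \<open>n\<close> both sides reduce to \<open>R n\<close>: the series
  \<open>E (n + 1)\<close> is 1 up to degree \<open>n\<close>, and parts \<open>d * m\<close> with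
  \<open>m > n\<close> exceed \<open>n\<close>.\<close>

lemma E_1_eq_gf_parts: "E 1 = gf_parts ((*) d ` {1..})"
proof (rule fps_ext)
  fix n
  have nth: "(q ^ ((n + 1) * m) * R m) $ i = 0" if "0 < m" "i \<le> n" for m i
  proof (rule fps_X_power_dvd_nth)
    show "fps_X ^ ((n + 1) * m) dvd q ^ ((n + 1) * m) * R m"
      by (intro dvd_mult2 X_dvd_q) simp
    show "i < (n + 1) * m" using that by (cases m) auto
  qed
  have "E 1 $ n = (R n * E (n + 1)) $ n"
    by (simp only: E_1[of n])
  also have "\<dots> = R n $ n"
  proof (rule fps_mult_nth_eq_left)
    show "E (n + 1) $ 0 = 1" by (simp add: E_def fps_total_nth R_0)
    show "E (n + 1) $ i = 0" if "0 < i" "i \<le> n" for i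
      unfolding E_def fps_total_nth
    proof (rule sum.neutral, rule ballI)
      fix m
      show "(q ^ ((n + 1) * m) * R m) $ i = 0"
        using nth[of m i] that by (cases "m = 0") (auto simp: R_0)
    qed
  qed
  also have "\<dots> = (R n * gf_parts ((*) d ` {n<..})) $ n"
  proof (rule fps_mult_nth_eq_left[symmetric])
    show "gf_parts ((*) d ` {n<..}) $ 0 = 1"
      using d_pos by (intro gf_parts_nth_0) auto
    show "gf_parts ((*) d ` {n<..}) $ i = 0" if "0 < i" "i \<le> n" for i
    proof -
      have "i < d * m" if "n < m" for m
        using that \<open>i \<le> n\<close> d_pos
        by (metis le_less_trans less_le_trans mult_le_mono1 Suc_leI One_nat_def mult_1)
      then show ?thesis
        using that by (subst gf_parts_nth, subst partitions_into_eq_empty) auto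
    qed
  qed
  also have "R n * gf_parts ((*) d ` {n<..}) = gf_parts ((*) d ` {1..n} \<union> (*) d ` {n<..})"
    unfolding R_def using d_pos by (subst gf_parts_Un) auto
  also have "(*) d ` {1..n} \<union> (*) d ` {n<..} = (*) d ` {1..}"
    by (force simp flip: image_Un intro: arg_cong[where f = "image ((*) d)"])
  finally show "E 1 $ n = gf_parts ((*) d ` {1..}) $ n" .
qed

section \<open>The recurrence for the Andrews-Merca series\<close>

lemma F_add_F_Suc:
  assumes k: "k > 0"
  shows "F k + F (Suc k) = q ^ pent k * (1 - q ^ (2 * k + 1)) * E 1"
proof -
  define f where "f m = q ^ ((k + 1) * (m + k)) * G (m + k) * R m" for m
  \<comment> \<open>The terms of \<open>F (Suc k)\<close> with the index moved up by one:
    \<open>(1 - q ^ m) * R m\<close> is \<open>R (m - 1)\<close> for \<open>m > 0\<close> and 0 for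
    \<open>m = 0\<close>.\<close>
  define g where "g m = q ^ ((k + 2) * (m + k)) * G (m + k) * ((1 - q ^ m) * R m)" for m
  have dvd_f: "fps_X ^ m dvd f m" and dvd_g: "fps_X ^ m dvd g m" for m
    unfolding f_def g_def by (intro dvd_mult2 X_dvd_q; simp)+
  have dvd_E: "fps_X ^ m dvd q ^ ((k + 1) * m) * R m" "fps_X ^ m dvd q ^ ((k + 2) * m) * R m" for m
    by (intro dvd_mult2 X_dvd_q; simp)+
  have pred: "R (k - 1) = (1 - q ^ k) * R k"
    using q_R_Suc[of "k - 1"] k by simp
  \<comment> \<open>The weights come from \<open>R (k - 1) = (1 - q ^ k) * R k\<close> and from
    \<open>Suc k choose 2 = k + (k choose 2)\<close>. The combined numerator has the factor
    \<open>1 - q ^ (m + k)\<close>, which cancels \<open>G (m + k)\<close>.\<close>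
  have key: "(1 - q ^ k) * f m + q ^ k * g m
      = (1 - q ^ k) * q ^ (k * (k + 1)) * (q ^ ((k + 1) * m) * R m)
        + q ^ (k * (k + 2)) * (q ^ ((k + 2) * m) * R m)" for m
  proof -
    have "(1 - q ^ k) * f m + q ^ k * g m
      = q ^ ((k + 1) * (m + k)) * ((1 - q ^ (m + k)) * G (m + k)) * R m * (1 - q ^ k + q ^ (m + k))"
      unfolding f_def g_def by (simp add: algebra_simps power_add)
    also have "(1 - q ^ (m + k)) * G (m + k) = 1"
      using k by (simp add: q_G)
    also have "q ^ ((k + 1) * (m + k)) * 1 * R m * (1 - q ^ k + q ^ (m + k))
      = (1 - q ^ k) * q ^ (k * (k + 1)) * (q ^ ((k + 1) * m) * R m)
        + q ^ (k * (k + 2)) * (q ^ ((k + 2) * m) * R m)"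
      by (simp add: algebra_simps power_add)
    finally show ?thesis .
  qed
  have "fps_total (\<lambda>m. q ^ ((Suc k + 1) * (m + Suc k)) * G (m + Suc k) * R m) = fps_total g"
  proof -
    have "fps_total g = fps_total (\<lambda>m. g (Suc m))"
      by (subst fps_total_Suc[OF dvd_g]) (simp add: g_def)
    also have "(\<lambda>m. g (Suc m)) = (\<lambda>m. q ^ ((Suc k + 1) * (m + Suc k)) * G (m + Suc k) * R m)"
      by (simp only: g_def q_R_Suc) simp
    finally show ?thesis by simp
  qed
  then have "F (Suc k) = q ^ (Suc k choose 2) * R k * fps_total g"
    by (simp add: F_def)
  moreover have "F k = q ^ (k choose 2) * R (k - 1) * fps_total f"
    by (simp add: F_def f_def[abs_def])
  ultimately have "F k + F (Suc k) = q ^ (k choose 2) * ((1 - q ^ k) * R k) * fps_total f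
      + q ^ (Suc k choose 2) * R k * fps_total g"
    by (simp only: pred)
  also have "Suc k choose 2 = k + (k choose 2)"
    by (simp add: numeral_2_eq_2)
  also have "q ^ (k choose 2) * ((1 - q ^ k) * R k) * fps_total f
      + q ^ (k + (k choose 2)) * R k * fps_total g
      = q ^ (k choose 2) * R k * ((1 - q ^ k) * fps_total f + q ^ k * fps_total g)"
    by (simp add: algebra_simps power_add)
  also have "(1 - q ^ k) * fps_total f + q ^ k * fps_total g
      = (1 - q ^ k) * q ^ (k * (k + 1)) * E (k + 1) + q ^ (k * (k + 2)) * E (k + 2)"
    unfolding E_def fps_total_mult[OF dvd_f] fps_total_mult[OF dvd_g]
      fps_total_mult[OF dvd_E(1)] fps_total_mult[OF dvd_E(2)] fps_total_add key ..
  also have "E (k + 2) = (1 - q ^ (k + 1)) * E (k + 1)"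
    using E_Suc[of "k + 1"] by simp
  \<comment> \<open>Uses \<open>(1 - q ^ k) + q ^ k * (1 - q ^ (k + 1)) = 1 - q ^ (2 * k +
    1)\<close>.\<close>
  also have "q ^ (k choose 2) * R k * ((1 - q ^ k) * q ^ (k * (k + 1)) * E (k + 1)
      + q ^ (k * (k + 2)) * ((1 - q ^ (k + 1)) * E (k + 1)))
      = q ^ pent k * (1 - q ^ (2 * k + 1)) * (R k * E (k + 1))"
    by (simp add: pent_def algebra_simps power_add mult_2_right)
  finally show ?thesis by (simp only: E_1[of k])
qed

text \<open>Since \<open>G (m + 1) * R m\<close> is \<open>R (m + 1)\<close>, \<open>F 1\<close> is
  the series \<open>E 2\<close> without its term at \<open>m = 0\<close>.\<close>

lemma F_1: "E 2 = 1 + F 1"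
proof -
  have "fps_X ^ m dvd q ^ (2 * m) * R m" for m
    by (intro dvd_mult2 X_dvd_q) simp
  from fps_total_Suc[OF this] have "E 2 = 1 + fps_total (\<lambda>m. q ^ (2 * Suc m) * R (Suc m))"
    unfolding E_def by (simp only: R_0) simp
  also have "fps_total (\<lambda>m. q ^ (2 * Suc m) * R (Suc m)) = F 1"
    unfolding F_def R_Suc by (simp add: R_0 binomial_eq_0 mult.assoc mult_2)
  finally show ?thesis .
qed

text \<open>\<open>E 1\<close> is the reciprocal of Euler's product. By the recurrence each new
  summand cancels the old remainder and leaves the next one.\<close>

theorem truncated_pentagonal:
  "(\<Sum>i<Suc k. (-1) ^ i * q ^ pent i * (1 - q ^ (2 * i + 1))) * E 1 = 1 + (-1) ^ k * F (Suc k)"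
proof (induction k)
  case 0
  have "E 2 = (1 - q) * E 1"
    using E_Suc[of 1] by (simp add: numeral_2_eq_2)
  then show ?case using F_1 by (simp add: pent_def binomial_eq_0)
next
  case (Suc k)
  have "(\<Sum>i<Suc (Suc k). (-1) ^ i * q ^ pent i * (1 - q ^ (2 * i + 1))) * E 1
      = 1 + (-1) ^ k * F (Suc k)
        + (-1) ^ Suc k * (q ^ pent (Suc k) * (1 - q ^ (2 * Suc k + 1)) * E 1)"
    unfolding sum.lessThan_Suc[of _ "Suc k"] distrib_right Suc.IH by (simp only: mult.assoc)
  also have "\<dots> = 1 + (-1) ^ k * F (Suc k) + (-1) ^ Suc k * (F (Suc k) + F (Suc (Suc k)))"
    by (simp only: F_add_F_Suc zero_less_Suc)
  finally show ?case by (simp add: algebra_simps)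
qed

section \<open>Positivity of the Andrews-Merca series\<close>

lemma F_nonneg: "fps_nonneg (F k)"
  unfolding F_def q_power R_def G_def
  by (intro fps_nonneg_mult fps_nonneg_X_power fps_nonneg_gf_parts fps_nonneg_total)

text \<open>The term \<open>m = 0\<close> contributes \<open>q ^ pent k * (R (k - 1) * G k)\<close>,
  whose lowest coefficient is 1; the rest is nonnegative.\<close>

lemma F_nth_pent:
  assumes k: "k > 0"
  shows "F k $ (d * pent k) > 0"
proof -
  define f where "f m = q ^ ((k + 1) * (m + k)) * G (m + k) * R m" for m
  have dvd: "fps_X ^ m dvd f m" for m
    unfolding f_def by (intro dvd_mult2 X_dvd_q) simp
  have "F k = q ^ (k choose 2) * R (k - 1) * (f 0 + fps_total (\<lambda>m. f (Suc m)))"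
    unfolding F_def fps_total_Suc[OF dvd, symmetric] by (simp add: f_def[abs_def])
  also have "\<dots> = q ^ pent k * (R (k - 1) * G k)
      + q ^ (k choose 2) * R (k - 1) * fps_total (\<lambda>m. f (Suc m))"
    by (simp add: f_def R_0 pent_def algebra_simps power_add)
  finally have eq: "F k = \<dots>" .
  have "fps_nonneg (q ^ (k choose 2) * R (k - 1) * fps_total (\<lambda>m. f (Suc m)))"
    unfolding f_def q_power R_def G_def
    by (intro fps_nonneg_mult fps_nonneg_X_power fps_nonneg_gf_parts fps_nonneg_total)
  moreover have "(q ^ pent k * (R (k - 1) * G k)) $ (d * pent k) = 1"
  proof -
    have "R (k - 1) $ 0 = 1" "G k $ 0 = 1"
      unfolding R_def G_def using k d_pos by (intro gf_parts_nth_0; auto)+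
    then show ?thesis by (simp add: q_power fps_X_power_mult_nth)
  qed
  ultimately show ?thesis
    unfolding eq by (simp add: fps_nonneg_def add_pos_nonneg)
qed

end

section \<open>Regular partitions\<close>

lemma six_pent: "6 * pent i = 3 * i * (3 * i + 1)"
proof -
  have "2 * (i choose 2) = i * (i - 1)"
    unfolding choose_two by (intro dvd_mult_div_cancel) (cases i; simp)
  moreover have "6 * pent i = 3 * (2 * (i choose 2)) + 6 * (i * (i + 1))"
    by (simp add: pent_def)
  ultimately have "6 * pent i = 3 * (i * (i - 1)) + 6 * (i * (i + 1))"
    by (simp only:)
  then show ?thesis by (cases i) (simp_all add: algebra_simps)
qed

lemma num_regular_partitions_eq:
  "int (num_regular_partitions l n) = gf_parts {x. x > 0 \<and> \<not> l dvd x} $ n"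
  unfolding num_regular_partitions_def gf_parts_nth
  by (intro arg_cong[where f = "\<lambda>S. int (card S)"])
     (auto simp: int_partitions_def partitions_into_def)

lemma num_partitions_eq:
  "int (num_partitions (int n - int a)) = (fps_X ^ a * gf_parts {0<..}) $ n"
proof -
  have "int_partitions m = partitions_into {0<..} m" for m
    by (auto simp: int_partitions_def partitions_into_def)
  then show ?thesis
    by (auto simp: num_partitions_def fps_X_power_mult_nth nat_diff_distrib')
qed

text \<open>Pairing \<open>j = - i\<close> with \<open>j = i + 1\<close> matches the two terms of
  \<open>q ^ pent i * (1 - q ^ (2 * i + 1))\<close>.\<close>

lemma sum_symmetric_interval:
  fixes f :: "int \<Rightarrow> int"
  shows "(\<Sum>j = - (int k - 1)..int k. f j) = (\<Sum>i<k. f (- int i) + f (int i + 1))"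
proof (induction k)
  case (Suc k)
  have "{- (int (Suc k) - 1)..int (Suc k)}
      = insert (- int k) (insert (int k + 1) {- (int k - 1)..int k})"
    by auto
  then have "(\<Sum>j = - (int (Suc k) - 1)..int (Suc k). f j)
      = f (- int k) + (f (int k + 1) + (\<Sum>j = - (int k - 1)..int k. f j))"
    by (simp only:) simp
  then show ?case by (simp only: Suc.IH) simp
qed simp

lemma fps_const_minus_one_power: "fps_const ((-1) ^ i) = ((-1) ^ i :: int fps)"
  by (simp flip: fps_const_power fps_const_neg)

lemma sum_num_partitions_eq:
  "(\<Sum>j = - (int k - 1)..int k.
      int_sign j * int (num_partitions (int n - 3 * j * (3 * j - 1))))
   = ((\<Sum>i<k. (-1) ^ i * fps_X ^ (6 * pent i) * (1 - fps_X ^ (6 * (2 * i + 1))))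
        * gf_parts {0<..}) $ n"
proof -
  have "int_sign (- int i) * int (num_partitions (int n - 3 * (- int i) * (3 * (- int i) - 1)))
      + int_sign (int i + 1) * int (num_partitions (int n - 3 * (int i + 1) * (3 * (int i + 1) - 1)))
      = ((-1) ^ i * fps_X ^ (6 * pent i) * (1 - fps_X ^ (6 * (2 * i + 1))) * gf_parts {0<..}) $ n"
    for i
  proof -
    have sign: "nat \<bar>int i + 1\<bar> = Suc i" by simp
    have "3 * (- int i) * (3 * (- int i) - 1) = int (6 * pent i)"
      unfolding six_pent by (simp add: algebra_simps)
    moreover have "3 * (int i + 1) * (3 * (int i + 1) - 1) = int (6 * pent i + 6 * (2 * i + 1))"
      unfolding six_pent by (simp add: algebra_simps)
    moreover have "(-1) ^ i * fps_X ^ (6 * pent i) * (1 - fps_X ^ (6 * (2 * i + 1))) * gf_parts {0<..}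
        = fps_const ((-1) ^ i) * (fps_X ^ (6 * pent i) * gf_parts {0<..}
            - fps_X ^ (6 * pent i + 6 * (2 * i + 1)) * gf_parts {0<..})"
      by (simp add: fps_const_minus_one_power algebra_simps power_add)
    ultimately show ?thesis
      unfolding sign by (simp only: num_partitions_eq fps_mult_left_const_nth fps_sub_nth)
        (simp add: algebra_simps)
  qed
  then show ?thesis
    unfolding sum_symmetric_interval sum_distrib_right by (simp add: fps_sum_nth)
qed

lemma gf_regular_pos:
  assumes "l > 1"
  shows "gf_parts {x. x > 0 \<and> \<not> l dvd x} $ n > 0"
proof -
  have "replicate_mset n 1 \<in> partitions_into {x. x > 0 \<and> \<not> l dvd x} n"
    using assms by (auto simp: partitions_into_def)
  then show ?thesis
    by (auto simp: card_gt_0_iff intro!: finite_partitions_into)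
qed

theorem corollary8p1:
  fixes n k :: nat
  assumes "k > 0"
  shows "(-1) ^ k * (int (num_regular_partitions 6 n)
            - (\<Sum>j = - (int k - 1)..int k.
                 int_sign j * int (num_partitions (int n - 3 * j * (3 * j - 1))))) \<ge> 0
       \<and> (n \<ge> 3 * k * (3 * k + 1) \<longrightarrow>
          (-1) ^ k * (int (num_regular_partitions 6 n)
            - (\<Sum>j = - (int k - 1)..int k.
                 int_sign j * int (num_partitions (int n - 3 * j * (3 * j - 1))))) > 0)"
proof -
  interpret dilation 6 by standard simp
  define B where "B = gf_parts {x. x > 0 \<and> \<not> 6 dvd x}"
  define T where "T = (\<Sum>i<k. (-1) ^ i * q ^ pent i * (1 - q ^ (2 * i + 1)))"
  have "{0<..} = (*) 6 ` {1..} \<union> {x::nat. x > 0 \<and> \<not> 6 dvd x}"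
    by (auto elim!: dvdE)
  then have P: "gf_parts {0<..} = E 1 * B"
    unfolding E_1_eq_gf_parts B_def by (simp only:) (subst gf_parts_Un; auto)
  obtain m where m: "k = Suc m" using assms by (cases k) auto
  have "T * E 1 = 1 + (-1) ^ m * F k"
    unfolding T_def m by (rule truncated_pentagonal)
  then have "(-1) ^ k * (B - T * gf_parts {0<..}) = (-1) ^ k * (B - (1 + (-1) ^ m * F k) * B)"
    by (simp only: P mult.assoc[symmetric])
  also have "\<dots> = F k * B"
  proof -
    have "(-1) ^ k * (B - (1 + (-1) ^ m * F k) * B) = ((-1) ^ m * (-1) ^ m) * (F k * B)"
      by (simp add: m algebra_simps)
    also have "(-1) ^ m * (-1) ^ m = (1 :: int fps)"
      by (simp flip: power_mult_distrib)
    finally show ?thesis by simp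
  qed
  finally have "fps_const ((-1) ^ k) * (B - T * gf_parts {0<..}) = F k * B"
    by (simp only: fps_const_minus_one_power)
  then have "(F k * B) $ n = (-1) ^ k * (B $ n - (T * gf_parts {0<..}) $ n)"
    by (metis fps_mult_left_const_nth fps_sub_nth)
  then have eq: "(-1) ^ k * (int (num_regular_partitions 6 n)
            - (\<Sum>j = - (int k - 1)..int k.
                 int_sign j * int (num_partitions (int n - 3 * j * (3 * j - 1))))) = (F k * B) $ n"
    by (simp only: num_regular_partitions_eq sum_num_partitions_eq T_def B_def q_power)
  have nonneg: "0 \<le> F k $ i * B $ j" for i j
    using F_nonneg[of k] fps_nonneg_gf_parts by (simp add: fps_nonneg_def B_def)
  have "(F k * B) $ n > 0" if "n \<ge> 3 * k * (3 * k + 1)"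
  proof -
    \<comment> \<open>One positive term of the Cauchy product suffices; since
      \<open>6 * pent k = 3 * k * (3 * k + 1)\<close>, the bound on \<open>n\<close> puts it in
      range.\<close>
    have "0 < F k $ (6 * pent k) * B $ (n - 6 * pent k)"
      using F_nth_pent[OF assms] gf_regular_pos[of 6] by (simp add: B_def)
    also have "\<dots> \<le> (\<Sum>i=0..n. F k $ i * B $ (n - i))"
      by (rule member_le_sum) (use that nonneg in \<open>auto simp: six_pent\<close>)
    finally show ?thesis by (simp only: fps_mult_nth)
  qed
  moreover have "(F k * B) $ n \<ge> 0"
    unfolding fps_mult_nth by (intro sum_nonneg nonneg)
  ultimately show ?thesis unfolding eq by blast
qed

end
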